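(* Let $s,t\ge1$ be any integers (not necessarily coprime), and let $\lambda$ be an $s$-core. Then for every $j\in\mathbb{Z}$, $$\bigl|[\mathcal{S}_s(\lambda)-s]\cap(j+t\mathbb{Z})\bigr| = \frac{1}{t}\bigl(a_{t,j}(\lambda^t)-[a_{t,j+s}(\lambda^t)-s]\bigr),$$ where $\lambda^t$ denotes the $t$-core of $\lambda$.
   Context: A partition is an infinite weakly decreasing sequence $\lambda=(\lambda_1,\lambda_2,\ldots)$ of nonnegative integers with finite sum. Its Young diagram is $[\lambda]=\{(r,c)\in\mathbb{Z}_{>0}^2 : c\le\lambda_r\}$, its conjugate $\overline{\lambda}$ is given by $\overline{\lambda}_r=\#\{c\in\mathbb{Z}_{>0}: r\le\lambda_c\}$. The rim hook of $(r,c)\in[\lambda]$ is $\{(i,j)\in[\lambda]: i\ge r,\ j\ge c,\ (i+1,j+1)\notin[\lambda]\}$, of length $1+(\lambda_r-r)+(\overline{\lambda}_c-c)$; removing it leaves the Young diagram of a smaller partition. A partition is an $s$-core if it has no rim hook of length $s$. For any partition $\lambda$ and $t\ge1$, repeatedly removing rim hooks of length $t$ until none remains yields a $t$-core, independent of the choices made, denoted $\lambda^t$ and called the $t$-core of $\lambda$. The beta-set of $\lambda$ is $B^\lambda=\{\lambda_i-i: i\ge1\}\subset\mathbb{Z}$; $\lambda$ is an $s$-core iff $B^\lambda-s\subseteq B^\lambda$. For an $s$-core $\lambda$ and $i\in\mathbb{Z}$ (only $i$ mod $s$ matters) put $a_{s,i}(\lambda)=s+\max[B^\lambda\cap(i+s\mathbb{Z})]$,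 and let $\mathcal{S}_s(\lambda)=\{a_{s,i}(\lambda)\}_{i\in\mathbb{Z}/s\mathbb{Z}}=(B^\lambda+s)\setminus B^\lambda$ (the $s$-set of $\lambda$). The same notation is used with $t$ in place of $s$ for $t$-cores. For a set $X\subseteq\mathbb{Z}$, $X-s=\{x-s:x\in X\}$. *)

theory Defs
  imports Complex_Main
begin

(* A partition (lam_1, lam_2, ...) is a function nat => nat used at the indices >= 1. The
   irrelevant value at 0 is set to 0, so that distinct functions are distinct partitions. *)
definition is_partition :: "(nat \<Rightarrow> nat) \<Rightarrow> bool" where
  "is_partition lam \<longleftrightarrow>
     lam 0 = 0 \<and> (\<forall>i j. 1 \<le> i \<and> i \<le> j \<longrightarrow> lam j \<le> lam i) \<and> finite {i. lam i \<noteq> 0}"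

definition diagram :: "(nat \<Rightarrow> nat) \<Rightarrow> (nat \<times> nat) set" where
  "diagram lam = {(r, c). 1 \<le> r \<and> 1 \<le> c \<and> c \<le> lam r}"

definition conjugate :: "(nat \<Rightarrow> nat) \<Rightarrow> nat \<Rightarrow> nat" where
  "conjugate lam r = card {c. 1 \<le> c \<and> r \<le> lam c}"

definition rim_hook :: "(nat \<Rightarrow> nat) \<Rightarrow> nat \<Rightarrow> nat \<Rightarrow> (nat \<times> nat) set" where
  "rim_hook lam r c =
     {(i, j). (i, j) \<in> diagram lam \<and> r \<le> i \<and> c \<le> j \<and> (i + 1, j + 1) \<notin> diagram lam}"

definition hook_length :: "(nat \<Rightarrow> nat) \<Rightarrow> nat \<Rightarrow> nat \<Rightarrow> int" where
  "hook_length lam r c = 1 + (int (lam r) - int r) + (int (conjugate lam c) - int c)"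

definition is_core :: "int \<Rightarrow> (nat \<Rightarrow> nat) \<Rightarrow> bool" where
  "is_core s lam \<longleftrightarrow>
     is_partition lam \<and> \<not> (\<exists>r c. (r, c) \<in> diagram lam \<and> hook_length lam r c = s)"

definition removes_hook :: "int \<Rightarrow> (nat \<Rightarrow> nat) \<Rightarrow> (nat \<Rightarrow> nat) \<Rightarrow> bool" where
  "removes_hook t lam mu \<longleftrightarrow>
     is_partition lam \<and> is_partition mu \<and>
     (\<exists>r c. (r, c) \<in> diagram lam \<and> hook_length lam r c = t \<and>
            diagram mu = diagram lam - rim_hook lam r c)"

definition core_of :: "int \<Rightarrow> (nat \<Rightarrow> nat) \<Rightarrow> (nat \<Rightarrow> nat)" where
  "core_of t lam = (THE mu. (removes_hook t)\<^sup>*\<^sup>* lam mu \<and> is_core t mu)"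

definition beta_set :: "(nat \<Rightarrow> nat) \<Rightarrow> int set" where
  "beta_set lam = {int (lam i) - int i | i. 1 \<le> i}"

definition residue_class :: "int \<Rightarrow> int \<Rightarrow> int set" where
  "residue_class i s = {i + s * k | k. True}"

(* GREATEST rather than Max, since the set is infinite (but bounded above). *)
definition a_num :: "int \<Rightarrow> int \<Rightarrow> (nat \<Rightarrow> nat) \<Rightarrow> int" where
  "a_num s i lam = s + (GREATEST b. b \<in> beta_set lam \<inter> residue_class i s)"

(* The index runs over all integers; a_num s i lam depends only on i modulo s. *)
definition s_set :: "int \<Rightarrow> (nat \<Rightarrow> nat) \<Rightarrow> int set" where
  "s_set s lam = {a_num s i lam | i. True}"

definition shift_down :: "int set \<Rightarrow> int \<Rightarrow> int set" where
  "shift_down X s = {x - s | x. x \<in> X}"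

end

theory Submission
  imports Defs
begin

(* Removing a rim hook of length t moves one element b of the beta-set to b - t. Hence it
   preserves, for each class modulo t, the relative size rel_card of the beta-set compared with
   any other beta-set. For an s-core, the left-hand side is the relative size of B and B - s in
   the class of j, because S_s - s = B \ (B - s). By the cocycle property of rel_card, B may be
   replaced by the beta-set of the t-core, whose part in each class modulo t is an initial
   segment bounded by a_num; the relative size is then the length of an arithmetic progression. *)

section \<open>Membership in residue classes and translates\<close>

lemma mem_residue_class: "x \<in> residue_class i s \<longleftrightarrow> s dvd (x - i)"
  unfolding residue_class_def dvd_def by (auto simp: algebra_simps)

lemma mem_shift_down: "x \<in> shift_down X s \<longleftrightarrow> x + s \<in> X"
  unfolding shift_down_def by force


section \<open>Relative cardinality of sets with finite difference\<close>

text \<open>A stand-in for |X| - |Y| when both sets are infinite. It is meaningful under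
  \<open>almost_eq\<close>, since \<open>card\<close> of an infinite set is 0.\<close>

definition rel_card :: "'a set \<Rightarrow> 'a set \<Rightarrow> int" where
  "rel_card X Y = int (card (X - Y)) - int (card (Y - X))"

definition almost_eq :: "'a set \<Rightarrow> 'a set \<Rightarrow> bool" where
  "almost_eq X Y \<longleftrightarrow> finite (X - Y) \<and> finite (Y - X)"

lemma almost_eq_sym: "almost_eq X Y \<Longrightarrow> almost_eq Y X"
  by (auto simp: almost_eq_def)

lemma almost_eq_trans:
  assumes "almost_eq X Y" "almost_eq Y Z"
  shows "almost_eq X Z"
proof -
  have "X - Z \<subseteq> (X - Y) \<union> (Y - Z)" "Z - X \<subseteq> (Z - Y) \<union> (Y - X)" by auto
  with assms show ?thesis
    unfolding almost_eq_def by (meson finite_UnI finite_subset)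
qed

lemma rel_card_swap: "rel_card Y X = - rel_card X Y"
  by (simp add: rel_card_def)

text \<open>X and Y agree outside the finite window U, and inside it their common part cancels. This
  turns \<open>rel_card\<close> into a genuine difference of cardinalities.\<close>

lemma rel_card_cutoff:
  assumes "finite U" "X - Y \<subseteq> U" "Y - X \<subseteq> U"
  shows "rel_card X Y = int (card (X \<inter> U)) - int (card (Y \<inter> U))"
proof -
  have "X \<inter> U = (X - Y) \<union> (X \<inter> Y \<inter> U)" "Y \<inter> U = (Y - X) \<union> (X \<inter> Y \<inter> U)"
    using assms by auto
  moreover have "card ((X - Y) \<union> (X \<inter> Y \<inter> U)) = card (X - Y) + card (X \<inter> Y \<inter> U)"
    "card ((Y - X) \<union> (X \<inter> Y \<inter> U)) = card (Y - X) + card (X \<inter> Y \<inter> U)"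
    by (rule card_Un_disjoint; use assms in \<open>auto intro: finite_subset\<close>)+
  ultimately show ?thesis by (simp add: rel_card_def)
qed

lemma rel_card_trans:
  assumes "almost_eq X Y" "almost_eq Y Z"
  shows "rel_card X Z = rel_card X Y + rel_card Y Z"
proof -
  \<comment> \<open>One window serves all three pairs, since X - Z and Z - X lie in it as well; the
    cardinalities then telescope.\<close>
  define U where "U = (X - Y) \<union> (Y - X) \<union> (Y - Z) \<union> (Z - Y)"
  have "finite U" using assms by (simp add: U_def almost_eq_def)
  then have "rel_card X Y = int (card (X \<inter> U)) - int (card (Y \<inter> U))"
    "rel_card Y Z = int (card (Y \<inter> U)) - int (card (Z \<inter> U))"
    "rel_card X Z = int (card (X \<inter> U)) - int (card (Z \<inter> U))"
    by (intro rel_card_cutoff; auto simp: U_def)+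
  then show ?thesis by simp
qed

lemma rel_card_eq_0_subset:
  assumes "almost_eq X Y" "rel_card X Y = 0" "X \<subseteq> Y"
  shows "X = Y"
proof -
  have "X - Y = {}" using assms(3) by auto
  with assms have "Y - X = {}" by (simp add: rel_card_def almost_eq_def)
  with assms(3) show ?thesis by auto
qed

section \<open>Counting in arithmetic progressions\<close>

lemma card_residue_interval:
  assumes "t \<ge> 1" "t dvd (p - j)" "t dvd (q - j)" "q \<le> p"
  shows "finite {x \<in> residue_class j t. q \<le> x \<and> x < p}"
    and "t * int (card {x \<in> residue_class j t. q \<le> x \<and> x < p}) = p - q"
proof -
  obtain k l where "p - j = t * k" "q - j = t * l"
    using assms(2,3) by (auto elim!: dvdE)
  then have p: "p = j + t * k" and q: "q = j + t * l" by auto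
  have lk: "l \<le> k" using assms(1,4) p q by simp
  have eq: "{x \<in> residue_class j t. q \<le> x \<and> x < p} = (\<lambda>m. j + t * m) ` {l..<k}"
    unfolding residue_class_def using assms(1) by (auto simp: p q)
  show "finite {x \<in> residue_class j t. q \<le> x \<and> x < p}" by (simp add: eq)
  have "inj_on (\<lambda>m. j + t * m) {l..<k}" using assms(1) by (auto simp: inj_on_def)
  then have "card {x \<in> residue_class j t. q \<le> x \<and> x < p} = nat (k - l)"
    unfolding eq by (simp add: card_image)
  then show "t * int (card {x \<in> residue_class j t. q \<le> x \<and> x < p}) = p - q"
    using lk by (simp add: p q algebra_simps)
qed

text \<open>One segment contains the other, so the difference is an interval of the progression. The
  case p < q follows by the antisymmetry of \<open>rel_card\<close>.\<close>

lemma rel_card_residue_segments: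
  assumes "t \<ge> 1" "t dvd (p - j)" "t dvd (q - j)"
  shows "almost_eq {x \<in> residue_class j t. x < p} {x \<in> residue_class j t. x < q}"
    and "t * rel_card {x \<in> residue_class j t. x < p} {x \<in> residue_class j t. x < q} = p - q"
proof -
  let ?S = "\<lambda>p. {x \<in> residue_class j t. x < p}"
  have diff: "?S p - ?S q = {x \<in> residue_class j t. q \<le> x \<and> x < p}" for p q by auto
  have *: "almost_eq (?S p) (?S q) \<and> t * rel_card (?S p) (?S q) = p - q"
    if "t dvd (p - j)" "t dvd (q - j)" "q \<le> p" for p q
  proof -
    have sub: "?S q - ?S p = {}" using that by auto
    show ?thesis
      unfolding almost_eq_def rel_card_def sub diff[of p q]
      using card_residue_interval[OF assms(1) that] by simp
  qed
  have "almost_eq (?S p) (?S q) \<and> t * rel_card (?S p) (?S q) = p - q"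
  proof (cases "q \<le> p")
    case True
    then show ?thesis using * assms by blast
  next
    case False
    then have "almost_eq (?S q) (?S p) \<and> t * rel_card (?S q) (?S p) = q - p"
      using * assms by simp
    then show ?thesis using rel_card_swap[of "?S p" "?S q"] almost_eq_sym by fastforce
  qed
  then show "almost_eq (?S p) (?S q)" "t * rel_card (?S p) (?S q) = p - q" by auto
qed

text \<open>The source of the index j + s in the theorem: translation by -s carries the class of j +
  s onto the class of j.\<close>

lemma shift_down_residue_class:
  "shift_down X s \<inter> residue_class j t = shift_down (X \<inter> residue_class (j + s) t) s"
  by (auto simp: mem_shift_down mem_residue_class)

lemma shift_down_image: "shift_down X s = (\<lambda>x. x - s) ` X"
  by (auto simp: shift_down_def)

lemma card_shift_down: "card (shift_down X s) = card X"
  by (simp add: shift_down_image card_image inj_on_def)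

lemma shift_down_diff: "shift_down (X - Y) s = shift_down X s - shift_down Y s"
  by (auto simp: mem_shift_down)

lemma rel_card_shift_down: "rel_card (shift_down X s) (shift_down Y s) = rel_card X Y"
  by (simp add: rel_card_def card_shift_down flip: shift_down_diff)

lemma almost_eq_shift_down: "almost_eq X Y \<Longrightarrow> almost_eq (shift_down X s) (shift_down Y s)"
  unfolding almost_eq_def shift_down_diff[symmetric] by (auto simp: shift_down_image)


section \<open>Beta-sets and conjugates of partitions\<close>

lemma partition_antimono: "is_partition lam \<Longrightarrow> 1 \<le> i \<Longrightarrow> i \<le> k \<Longrightarrow> lam k \<le> lam i"
  by (auto simp: is_partition_def)

lemma partition_eventually_0:
  assumes "is_partition lam"
  obtains N where "1 \<le> N" "\<And>i. N \<le> i \<Longrightarrow> lam i = 0"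
proof -
  have "finite {i. lam i \<noteq> 0}" using assms by (simp add: is_partition_def)
  then obtain M where "\<forall>i\<in>{i. lam i \<noteq> 0}. i < M"
    using finite_nat_set_iff_bounded by blast
  then show ?thesis using that[of "Suc M"] by force
qed

lemma finite_diagram:
  assumes "is_partition lam"
  shows "finite (diagram lam)"
proof -
  obtain N where N: "1 \<le> N" "\<And>i. N \<le> i \<Longrightarrow> lam i = 0" using partition_eventually_0[OF assms] by blast
  have "diagram lam \<subseteq> {..N} \<times> {..lam 1}"
  proof
    fix z assume "z \<in> diagram lam"
    then obtain r c where z: "z = (r, c)" "1 \<le> r" "1 \<le> c" "c \<le> lam r"
      by (auto simp: diagram_def)
    have "r \<le> N" using N(2)[of r] z by (cases "r \<le> N") auto
    moreover have "c \<le> lam 1" using partition_antimono[OF assms, of 1 r] z by simp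
    ultimately show "z \<in> {..N} \<times> {..lam 1}" using z by simp
  qed
  then show ?thesis by (rule finite_subset) simp
qed

lemma diagram_inj:
  assumes "is_partition lam" "is_partition mu" "diagram lam = diagram mu"
  shows "lam = mu"
proof
  fix i
  show "lam i = mu i"
  proof (cases "i = 0")
    case True
    then show ?thesis using assms by (simp add: is_partition_def)
  next
    case False
    have "1 \<le> c \<and> c \<le> lam i \<longleftrightarrow> 1 \<le> c \<and> c \<le> mu i" for c
      using arg_cong[OF assms(3), of "\<lambda>D. (i, c) \<in> D"] False by (auto simp: diagram_def)
    from this[of "lam i"] this[of "mu i"] show ?thesis by linarith
  qed
qed

text \<open>Row lengths decrease weakly, so the rows reaching column c are 1..n for some n, and
  \<open>conjugate lam c\<close> counts them.\<close>

lemma le_conjugate_iff: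
  assumes "is_partition lam" "1 \<le> i" "1 \<le> c"
  shows "i \<le> conjugate lam c \<longleftrightarrow> c \<le> lam i"
proof -
  let ?S = "{i. 1 \<le> i \<and> c \<le> lam i}"
  have "?S \<subseteq> {i. lam i \<noteq> 0}" using assms(3) by auto
  then have fin: "finite ?S" using assms(1) finite_subset by (auto simp: is_partition_def)
  obtain n where n: "?S = {1..n}"
  proof (cases "?S = {}")
    case True
    then show ?thesis using that[of 0] by simp
  next
    case False
    have mx: "Max ?S \<in> ?S" using Max_in[OF fin False] .
    have "?S = {1..Max ?S}"
    proof (intro equalityI subsetI)
      fix i assume "i \<in> ?S"
      then show "i \<in> {1..Max ?S}" using Max_ge[OF fin] by simp
    next
      fix i assume i: "i \<in> {1..Max ?S}"
      then have "lam (Max ?S) \<le> lam i" by (intro partition_antimono[OF assms(1)]) auto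
      then show "i \<in> ?S" using mx i by simp
    qed
    then show ?thesis by (rule that)
  qed
  then have "conjugate lam c = n" by (simp add: conjugate_def)
  then show ?thesis using n assms(2) by (auto simp: set_eq_iff)
qed

section \<open>The beta-set and its complement\<close>

lemma beta_strict_antimono:
  assumes "is_partition lam" "1 \<le> i" "i < k"
  shows "int (lam k) - int k < int (lam i) - int i"
  using partition_antimono[OF assms(1,2), of k] assms(3) by simp

lemma beta_inj:
  assumes "is_partition lam" "1 \<le> i" "1 \<le> k" "int (lam k) - int k = int (lam i) - int i"
  shows "i = k"
proof (cases i k rule: linorder_cases)
  case less
  then show ?thesis using beta_strict_antimono[OF assms(1,2)] assms(4) by fastforce
next
  case greater
  then show ?thesis using beta_strict_antimono[OF assms(1,3)] assms(4) by fastforce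
qed

text \<open>The part lam i can be read off from the i-th largest element of the beta-set. Strong
  induction on i, with the inequality \<open>le\<close> applied in both directions.\<close>

lemma beta_set_inj:
  assumes "is_partition lam" "is_partition mu" "beta_set lam = beta_set mu"
  shows "lam = mu"
proof
  have le: "lam i \<le> mu i"
    if "is_partition lam" "is_partition mu" "beta_set lam = beta_set mu"
      "1 \<le> i" "\<forall>k<i. lam k = mu k" for i lam mu
  proof -
    have "int (lam i) - int i \<in> beta_set mu"
      unfolding that(3)[symmetric] using that(4) by (auto simp: beta_set_def)
    then obtain k where k: "1 \<le> k" "int (lam i) - int i = int (mu k) - int k"
      by (auto simp: beta_set_def)
    \<comment> \<open>Below i the two partitions agree, so k < i would give rows i and k of lam the
      same beta-number. Then lam i = mu k - (k - i), which is at most mu i.\<close>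
    have "i \<le> k"
      using beta_inj[OF that(1) k(1) that(4)] k(2) that(5) by (cases "k < i") auto
    then show ?thesis using partition_antimono[OF that(2,4), of k] k(2) by simp
  qed
  fix i
  show "lam i = mu i"
  proof (induction i rule: less_induct)
    case (less i)
    show ?case
    proof (cases "i = 0")
      case True
      then show ?thesis using assms by (simp add: is_partition_def)
    next
      case False
      then show ?thesis using le[of lam mu i] le[of mu lam i] less assms by (simp add: le_antisym)
    qed
  qed
qed

lemma beta_set_le: "is_partition lam \<Longrightarrow> b \<in> beta_set lam \<Longrightarrow> b \<le> int (lam 1)"
  unfolding beta_set_def using partition_antimono[of lam 1] by fastforce

lemma beta_set_ge:
  assumes "is_partition lam"
  obtains M where "\<And>x. x \<le> M \<Longrightarrow> x \<in> beta_set lam"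
proof -
  obtain N where N: "1 \<le> N" "\<And>i. N \<le> i \<Longrightarrow> lam i = 0" using partition_eventually_0[OF assms] by blast
  have "x \<in> beta_set lam" if "x \<le> - int N" for x
  proof -
    have "N \<le> nat (- x)" using that by simp
    then have "x = int (lam (nat (- x))) - int (nat (- x))" "1 \<le> nat (- x)"
      using N that by auto
    then show ?thesis unfolding beta_set_def by blast
  qed
  then show ?thesis by (rule that)
qed

text \<open>If row i reaches column c, its beta-number is larger than this value; otherwise it is
  smaller. By the next lemma, every gap of the beta-set has this form for some column.\<close>

lemma conjugate_not_in_beta_set:
  assumes "is_partition lam" "1 \<le> c"
  shows "int c - 1 - int (conjugate lam c) \<notin> beta_set lam"
proof
  assume "int c - 1 - int (conjugate lam c) \<in> beta_set lam"
  then obtain i where i: "1 \<le> i" "int c - 1 - int (conjugate lam c) = int (lam i) - int i"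
    by (auto simp: beta_set_def)
  show False
    using le_conjugate_iff[OF assms(1) i(1) assms(2)] i(2) by linarith
qed

lemma not_in_beta_setE:
  assumes "is_partition lam" "x \<notin> beta_set lam"
  obtains c where "1 \<le> c" "x = int c - 1 - int (conjugate lam c)"
proof -
  \<comment> \<open>The shift by \<open>Suc\<close> makes the least solution n the number of rows
    whose beta-number exceeds x, with n = 0 allowed.\<close>
  let ?P = "\<lambda>i. int (lam (Suc i)) - int (Suc i) < x"
  obtain N where N: "1 \<le> N" "\<And>i. N \<le> i \<Longrightarrow> lam i = 0" using partition_eventually_0[OF assms(1)] by blast
  have "?P (N + nat \<bar>x\<bar>)" using N(2)[of "Suc (N + nat \<bar>x\<bar>)"] by simp
  then have least: "?P (LEAST i. ?P i)" by (rule LeastI)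
  define n where "n = (LEAST i. ?P i)"
  have Pn: "?P n" using least by (simp add: n_def)
  have above: "x < int (lam n) - int n" if "1 \<le> n"
  proof -
    have "\<not> ?P (n - 1)" using that not_less_Least[of "n - 1" ?P] by (simp add: n_def)
    then have "x \<le> int (lam n) - int n" using that by simp
    moreover have "x \<noteq> int (lam n) - int n" using that assms(2) by (auto simp: beta_set_def)
    ultimately show ?thesis by simp
  qed
  \<comment> \<open>Solves x = c - 1 - n for c. Positivity comes from \<open>?P n\<close>, and n
    turns out to be the length of column c.\<close>
  define c where "c = nat (x + 1 + int n)"
  have c: "int c = x + 1 + int n" "1 \<le> c" using Pn by (auto simp: c_def)
  have "lam (Suc n) < c" using Pn c by simp
  then have "\<not> Suc n \<le> conjugate lam c" using le_conjugate_iff[OF assms(1), of "Suc n" c] c by simp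
  moreover have "n \<le> conjugate lam c"
  proof (cases "n = 0")
    case False
    then show ?thesis using above le_conjugate_iff[OF assms(1), of n c] c by simp
  qed simp
  ultimately have "conjugate lam c = n" by simp
  then show ?thesis using that[of c] c by simp
qed

text \<open>If b - s were a gap, it would belong to a column c, while b belongs to a row r. As b - s
  < b, the cell (r, c) lies in the diagram, and its hook length is b - (b - s) = s.\<close>

lemma core_beta_closed:
  assumes "is_core s lam" "s \<ge> 1" "b \<in> beta_set lam"
  shows "b - s \<in> beta_set lam"
proof (rule ccontr)
  have part: "is_partition lam" using assms(1) by (simp add: is_core_def)
  assume "b - s \<notin> beta_set lam"
  then obtain c where c: "1 \<le> c" "b - s = int c - 1 - int (conjugate lam c)"
    using not_in_beta_setE[OF part] by metis
  obtain r where r: "1 \<le> r" "b = int (lam r) - int r" using assms(3) by (auto simp: beta_set_def)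
  have "c \<le> lam r" using le_conjugate_iff[OF part r(1) c(1)] c r assms(2) by linarith
  then have "(r, c) \<in> diagram lam" "hook_length lam r c = s"
    using c r by (auto simp: diagram_def hook_length_def)
  then show False using assms(1) by (auto simp: is_core_def)
qed


section \<open>Removal of rim hooks\<close>

text \<open>A cell (i, k) of the rim hook has k \<ge> c and k \<ge> lam (i + 1), so row i keeps only
  its cells left of column max c (lam (i + 1)). The \<open>min\<close> preserves the rows that end
  before column c.\<close>

definition remove_rim :: "(nat \<Rightarrow> nat) \<Rightarrow> nat \<Rightarrow> nat \<Rightarrow> nat \<Rightarrow> nat" where
  "remove_rim lam r c i = (if i < r then lam i else min (lam i) (max c (lam (i + 1)) - 1))"

lemma remove_rim_partition:
  assumes "is_partition lam" "1 \<le> r"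
  shows "is_partition (remove_rim lam r c)"
proof -
  have "{i. remove_rim lam r c i \<noteq> 0} \<subseteq> {i. lam i \<noteq> 0}"
    by (auto simp: remove_rim_def split: if_splits)
  then have "finite {i. remove_rim lam r c i \<noteq> 0}"
    using assms(1) finite_subset by (auto simp: is_partition_def)
  moreover have "remove_rim lam r c k \<le> remove_rim lam r c i" if "1 \<le> i" "i \<le> k" for i k
    using partition_antimono[OF assms(1) that] partition_antimono[OF assms(1), of "i + 1" "k + 1"] that
    by (auto simp: remove_rim_def)
  ultimately show ?thesis using assms by (auto simp: is_partition_def remove_rim_def)
qed

lemma diagram_remove_rim:
  assumes "is_partition lam" "1 \<le> c"
  shows "diagram (remove_rim lam r c) = diagram lam - rim_hook lam r c"
  using assms(2) by (auto simp: diagram_def rim_hook_def remove_rim_def split: if_splits)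

text \<open>With n the length of column c, the hook occupies rows r to n. Each of the rows r to n -
  1 inherits the beta-number of the next row, and row n receives the gap c - 1 - n of column c.
  Hence only the beta-number of row r is lost.\<close>

lemma beta_set_remove_rim:
  assumes part: "is_partition lam" and rc: "(r, c) \<in> diagram lam"
  shows "beta_set (remove_rim lam r c) =
    insert (int (lam r) - int r - hook_length lam r c) (beta_set lam - {int (lam r) - int r})"
proof -
  let ?mu = "remove_rim lam r c" and ?n = "conjugate lam c"
  let ?f = "\<lambda>i. int (lam i) - int i" and ?g = "\<lambda>i. int (remove_rim lam r c i) - int i"
  have r: "1 \<le> r" and c: "1 \<le> c" "c \<le> lam r" using rc by (auto simp: diagram_def)
  have conj: "i \<le> ?n \<longleftrightarrow> c \<le> lam i" if "1 \<le> i" for i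
    using le_conjugate_iff[OF part that c(1)] .
  have rn: "r \<le> ?n" using conj r c by simp
  have mu_low: "?g i = ?f i" if "i < r" for i using that by (simp add: remove_rim_def)
  have mu_mid: "?g i = ?f (i + 1)" if "r \<le> i" "i < ?n" for i
  proof -
    have "c \<le> lam (i + 1)" "lam (i + 1) \<le> lam i"
      using conj[of "i + 1"] that r partition_antimono[OF part, of i "i + 1"] by auto
    then show ?thesis using that c by (auto simp: remove_rim_def)
  qed
  have mu_n: "?g ?n = int c - 1 - int ?n"
  proof -
    have "c \<le> lam ?n" "lam (?n + 1) < c" using conj[of ?n] conj[of "?n + 1"] r rn by auto
    then show ?thesis using rn c by (auto simp: remove_rim_def)
  qed
  have mu_high: "?g i = ?f i" if "?n < i" for i
  proof -
    have "lam i < c" using conj[of i] that by simp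
    then show ?thesis by (simp add: remove_rim_def)
  qed
  have hl: "?f r - hook_length lam r c = int c - 1 - int ?n" by (simp add: hook_length_def)
  show ?thesis unfolding hl
  proof (intro equalityI subsetI)
    fix x assume "x \<in> beta_set ?mu"
    then obtain i where i: "1 \<le> i" "x = ?g i" by (auto simp: beta_set_def)
    have other: "?f k \<in> beta_set lam - {?f r}" if "1 \<le> k" "k \<noteq> r" for k
      using that beta_inj[OF part that(1) r] by (auto simp: beta_set_def)
    consider "i < r" | "r \<le> i" "i < ?n" | "i = ?n" | "?n < i" by linarith
    then show "x \<in> insert (int c - 1 - int ?n) (beta_set lam - {?f r})"
    proof cases
      case 1
      then show ?thesis using i mu_low other[of i] by simp
    next
      case 2
      then show ?thesis using i mu_mid other[of "i + 1"] by simp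
    next
      case 3
      then show ?thesis using i mu_n by simp
    next
      case 4
      then show ?thesis using i mu_high other[of i] rn by simp
    qed
  next
    have mem: "?g i \<in> beta_set ?mu" if "1 \<le> i" for i using that unfolding beta_set_def by blast
    fix x assume "x \<in> insert (int c - 1 - int ?n) (beta_set lam - {?f r})"
    then consider "x = int c - 1 - int ?n" | i where "1 \<le> i" "x = ?f i" "i \<noteq> r"
      by (auto simp: beta_set_def)
    then show "x \<in> beta_set ?mu"
    proof cases
      case 1
      then show ?thesis using mem[of ?n] mu_n r rn by simp
    next
      case (2 i)
      consider "i < r" | "r < i" "i \<le> ?n" | "?n < i" using 2 by linarith
      then show ?thesis
      proof cases
        case 1
        then show ?thesis using mem[of i] mu_low 2 by simp
      next
        case mid: 2
        then have "?g (i - 1) = ?f i" "1 \<le> i - 1" using mu_mid[of "i - 1"] r by simp_all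
        then show ?thesis using mem[of "i - 1"] 2 by metis
      next
        case 3
        then show ?thesis using mem[of i] mu_high 2 by simp
      qed
    qed
  qed
qed

lemma removes_hook_beta:
  assumes "removes_hook t lam mu"
  obtains b where "b \<in> beta_set lam" "b - t \<notin> beta_set lam"
    "beta_set mu = insert (b - t) (beta_set lam - {b})"
proof -
  obtain r c where rc: "is_partition lam" "is_partition mu" "(r, c) \<in> diagram lam"
    "hook_length lam r c = t" "diagram mu = diagram lam - rim_hook lam r c"
    using assms by (auto simp: removes_hook_def)
  then have r: "1 \<le> r" "1 \<le> c" by (auto simp: diagram_def)
  \<comment> \<open>\<open>removes_hook\<close> specifies mu only through its diagram, which
    determines the partition.\<close>
  have mu: "mu = remove_rim lam r c"
    using diagram_inj[OF rc(2) remove_rim_partition[OF rc(1) r(1), of c]]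
      diagram_remove_rim[OF rc(1) r(2)] rc(5) by simp
  let ?b = "int (lam r) - int r"
  have "?b - t = int c - 1 - int (conjugate lam c)" using rc(4) by (simp add: hook_length_def)
  then have "?b - t \<notin> beta_set lam" using conjugate_not_in_beta_set[OF rc(1) r(2)] by simp
  moreover have "?b \<in> beta_set lam" using r by (auto simp: beta_set_def)
  ultimately show ?thesis
    using that[of ?b] beta_set_remove_rim[OF rc(1,3)] rc(4) mu by simp
qed

text \<open>b and b - t are congruent modulo t, so every class contains both or neither and gains as
  many elements as it loses.\<close>

lemma removes_hook_rel_card:
  assumes "removes_hook t lam mu"
  shows "almost_eq (beta_set lam \<inter> residue_class j t) (beta_set mu \<inter> residue_class j t)"
    and "rel_card (beta_set lam \<inter> residue_class j t) (beta_set mu \<inter> residue_class j t) = 0"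
proof -
  let ?C = "residue_class j t"
  obtain b where b: "b \<in> beta_set lam" "b - t \<notin> beta_set lam"
    "beta_set mu = insert (b - t) (beta_set lam - {b})"
    using removes_hook_beta[OF assms] .
  have C: "b - t \<in> ?C \<longleftrightarrow> b \<in> ?C"
    using dvd_add_left_iff[OF dvd_refl, of t "b - t - j"] by (simp add: mem_residue_class)
  have ne: "b \<noteq> b - t" using b by metis
  have diff: "beta_set lam \<inter> ?C - beta_set mu \<inter> ?C = {b} \<inter> ?C"
    "beta_set mu \<inter> ?C - beta_set lam \<inter> ?C = {b - t} \<inter> ?C"
    unfolding b(3) using b(1,2) ne by auto
  show "almost_eq (beta_set lam \<inter> ?C) (beta_set mu \<inter> ?C)"
    by (simp add: almost_eq_def diff)
  show "rel_card (beta_set lam \<inter> ?C) (beta_set mu \<inter> ?C) = 0"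
    unfolding rel_card_def diff using C by (cases "b \<in> ?C") auto
qed

lemma removes_hooks_rel_card:
  assumes "(removes_hook t)\<^sup>*\<^sup>* lam mu"
  shows "almost_eq (beta_set lam \<inter> residue_class j t) (beta_set mu \<inter> residue_class j t) \<and>
    rel_card (beta_set lam \<inter> residue_class j t) (beta_set mu \<inter> residue_class j t) = 0"
  using assms
proof (induction rule: rtranclp_induct)
  case base
  then show ?case by (simp add: almost_eq_def rel_card_def)
next
  case (step mu nu)
  note hook = removes_hook_rel_card[OF step.hyps(2), of j]
  show ?case
    using almost_eq_trans[OF conjunct1[OF step.IH] hook(1)]
      rel_card_trans[OF conjunct1[OF step.IH] hook(1)] step.IH hook(2) by simp
qed


section \<open>Cores\<close>

text \<open>The beta-set is closed under subtracting t, so in each class it consists of everything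
  up to its maximum m. Thus \<open>a_num\<close> = m + t is the first missing element. The proof
  also shows that the \<open>GREATEST\<close> in \<open>a_num\<close> is attained.\<close>

lemma core_beta_segment:
  assumes "is_core t mu" "t \<ge> 1"
  shows "t dvd (a_num t j mu - j)"
    and "beta_set mu \<inter> residue_class j t = {x \<in> residue_class j t. x < a_num t j mu}"
proof -
  let ?X = "beta_set mu \<inter> residue_class j t"
  have part: "is_partition mu" using assms(1) by (simp add: is_core_def)
  obtain M where M: "\<And>x. x \<le> M \<Longrightarrow> x \<in> beta_set mu" using beta_set_ge[OF part] by blast
  \<comment> \<open>An element of the class of j that is small enough to be at most M: as t \<ge> 1,
    it is at most j - |j| - |M|.\<close>
  define x0 where "x0 = j - t * (\<bar>j\<bar> + \<bar>M\<bar>)"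
  have "1 * (\<bar>j\<bar> + \<bar>M\<bar>) \<le> t * (\<bar>j\<bar> + \<bar>M\<bar>)" using assms(2) by (intro mult_right_mono) auto
  then have "x0 \<le> M" by (simp add: x0_def)
  then have x0: "x0 \<in> ?X" using M by (simp add: mem_residue_class x0_def)
  \<comment> \<open>A finite nonempty part of \<open>?X\<close> containing its largest element, so
    that \<open>Max\<close> applies.\<close>
  let ?Y = "?X \<inter> {x0..int (mu 1)}"
  have Y: "finite ?Y" "x0 \<in> ?Y" using x0 beta_set_le[OF part] by auto
  define m where "m = Max ?Y"
  have m: "m \<in> ?X" using Max_in[OF Y(1)] Y(2) unfolding m_def by blast
  have ge: "y \<le> m" if "y \<in> ?X" for y
  proof (cases "x0 \<le> y")
    case True
    then have "y \<in> ?Y" using that beta_set_le[OF part] by auto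
    then show ?thesis using Max_ge[OF Y(1)] by (simp add: m_def)
  next
    case False
    then show ?thesis using Max_ge[OF Y] by (simp add: m_def)
  qed
  have a: "a_num t j mu = t + m"
    unfolding a_num_def using Greatest_equality[of "\<lambda>b. b \<in> ?X" m] m ge by simp
  have mj: "t dvd (m - j)" using m by (simp add: mem_residue_class)
  have "t + m - j = (m - j) + t" by simp
  then show "t dvd (a_num t j mu - j)" unfolding a using mj by (metis dvd_add dvd_refl)
  have down: "m - t * int k \<in> beta_set mu" for k
  proof (induction k)
    case (Suc k)
    then show ?case using core_beta_closed[OF assms Suc] by (simp add: algebra_simps)
  qed (use m in simp)
  show "?X = {x \<in> residue_class j t. x < a_num t j mu}"
  proof (intro equalityI subsetI)
    fix x assume "x \<in> ?X"
    then show "x \<in> {x \<in> residue_class j t. x < a_num t j mu}" using ge[of x] a assms(2) by auto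
  next
    fix x assume x: "x \<in> {x \<in> residue_class j t. x < a_num t j mu}"
    then have "t dvd (x - j)" by (simp add: mem_residue_class)
    then have "t dvd (m - j) - (x - j)" using mj by (rule dvd_diff[rotated])
    then obtain k where k: "m - x = t * k" by (auto elim: dvdE)
    \<comment> \<open>From x < m + t follows k > -1, so x is reached from m by k downward steps of
      size t.\<close>
    have "t * (-1) < t * k" using x a k by simp
    then have "-1 < k" using assms(2) by (meson mult_less_cancel_left_pos less_le_trans zero_less_one)
    then have "x = m - t * int (nat k)" using k by simp
    then show "x \<in> ?X" using down[of "nat k"] x by blast
  qed
qed

section \<open>Existence and uniqueness of the core\<close>

lemma ex_core:
  assumes "is_partition lam"
  shows "\<exists>mu. (removes_hook t)\<^sup>*\<^sup>* lam mu \<and> is_core t mu"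
  using assms
proof (induction "card (diagram lam)" arbitrary: lam rule: less_induct)
  case less
  show ?case
  proof (cases "is_core t lam")
    case True
    then show ?thesis by blast
  next
    case False
    then obtain r c where rc: "(r, c) \<in> diagram lam" "hook_length lam r c = t"
      using less.prems by (auto simp: is_core_def)
    then have r: "1 \<le> r" "1 \<le> c" "c \<le> lam r" by (auto simp: diagram_def)
    let ?mu = "remove_rim lam r c"
    have part: "is_partition ?mu" using remove_rim_partition less.prems r by blast
    have dia: "diagram ?mu = diagram lam - rim_hook lam r c"
      using diagram_remove_rim less.prems r by blast
    have step: "removes_hook t lam ?mu"
      using less.prems part dia rc unfolding removes_hook_def by blast
    \<comment> \<open>The last cell of row r always lies on the rim hook, so the diagram shrinks
      strictly and the induction on its size applies.\<close>
    have "lam (r + 1) \<le> lam r" using partition_antimono[OF less.prems, of r "r + 1"] r by simp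
    then have "(r, lam r) \<in> diagram lam \<inter> rim_hook lam r c"
      using r by (auto simp: diagram_def rim_hook_def)
    then have "diagram ?mu \<subset> diagram lam" using dia by blast
    then have "card (diagram ?mu) < card (diagram lam)"
      using psubset_card_mono finite_diagram[OF less.prems] by blast
    then obtain nu where "(removes_hook t)\<^sup>*\<^sup>* ?mu nu" "is_core t nu"
      using less.hyps part by blast
    then show ?thesis using step converse_rtranclp_into_rtranclp by metis
  qed
qed

text \<open>Both cores have relative size 0 against lam, hence against each other, in every class.
  There they are initial segments, hence nested, hence equal. With \<open>ex_core\<close> this
  justifies the \<open>THE\<close> in \<open>core_of\<close>.\<close>

lemma core_unique:
  assumes "t \<ge> 1" "(removes_hook t)\<^sup>*\<^sup>* lam mu" "is_core t mu"
    "(removes_hook t)\<^sup>*\<^sup>* lam nu" "is_core t nu"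
  shows "mu = nu"
proof -
  have eq: "beta_set mu \<inter> residue_class j t = beta_set nu \<inter> residue_class j t" for j
  proof -
    let ?M = "beta_set mu \<inter> residue_class j t" and ?N = "beta_set nu \<inter> residue_class j t"
      and ?L = "beta_set lam \<inter> residue_class j t"
    have "almost_eq ?M ?L" "rel_card ?M ?L = 0" "almost_eq ?L ?N" "rel_card ?L ?N = 0"
      using removes_hooks_rel_card[OF assms(2), of j] removes_hooks_rel_card[OF assms(4), of j]
        almost_eq_sym rel_card_swap[of ?M ?L] by auto
    then have *: "almost_eq ?M ?N" "rel_card ?M ?N = 0"
      using almost_eq_trans[of ?M ?L ?N] rel_card_trans[of ?M ?L ?N] by auto
    consider "?M \<subseteq> ?N" | "?N \<subseteq> ?M"
      unfolding core_beta_segment(2)[OF assms(3,1)] core_beta_segment(2)[OF assms(5,1)]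
      using linear[of "a_num t j mu" "a_num t j nu"] by fastforce
    then show ?thesis
    proof cases
      case 1
      then show ?thesis using rel_card_eq_0_subset * by blast
    next
      case 2
      then show ?thesis
        using rel_card_eq_0_subset[OF almost_eq_sym[OF *(1)]] *(2) rel_card_swap[of ?N ?M] by simp
    qed
  qed
  have "x \<in> beta_set mu \<longleftrightarrow> x \<in> beta_set nu" for x
  proof -
    have "x \<in> residue_class x t" by (simp add: mem_residue_class)
    then show ?thesis using eq[of x] by blast
  qed
  then have "beta_set mu = beta_set nu" by blast
  then show ?thesis using beta_set_inj assms(3,5) by (simp add: is_core_def)
qed

lemma core_of:
  assumes "t \<ge> 1" "is_partition lam"
  shows "(removes_hook t)\<^sup>*\<^sup>* lam (core_of t lam)" and "is_core t (core_of t lam)"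
proof -
  have "\<exists>!mu. (removes_hook t)\<^sup>*\<^sup>* lam mu \<and> is_core t mu"
    using ex_core[OF assms(2)] core_unique[OF assms(1)] by blast
  from theI'[OF this]
  show "(removes_hook t)\<^sup>*\<^sup>* lam (core_of t lam)" "is_core t (core_of t lam)"
    unfolding core_of_def by auto
qed

text \<open>In each class modulo s the beta-set is everything below its \<open>a_num\<close> a, and
  its translate everything below a - s. The difference is the single element a - s.\<close>

lemma shift_down_s_set:
  assumes "s \<ge> 1" "is_core s lam"
  shows "shift_down (s_set s lam) s = beta_set lam - shift_down (beta_set lam) s"
proof -
  note seg = core_beta_segment[OF assms(2,1)]
  have below: "x \<in> beta_set lam \<longleftrightarrow> x < a_num s i lam" if "s dvd (x - i)" for x i
    using seg(2)[of i] that by (auto simp: mem_residue_class set_eq_iff)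
  show ?thesis
  proof (intro equalityI subsetI)
    fix x assume "x \<in> shift_down (s_set s lam) s"
    then obtain i where i: "x + s = a_num s i lam" by (auto simp: mem_shift_down s_set_def)
    have d: "s dvd (x + s - i)" using seg(1)[of i] i by simp
    then have "s dvd (x + s - i - s)" by (rule dvd_diff) simp
    then have "s dvd (x - i)" by simp
    then show "x \<in> beta_set lam - shift_down (beta_set lam) s"
      using below[OF d] below[of x i] i assms(1) by (simp add: mem_shift_down)
  next
    fix x assume "x \<in> beta_set lam - shift_down (beta_set lam) s"
    then have x: "x < a_num s x lam" "\<not> x + s < a_num s x lam"
      using below[of x x] below[of "x + s" x] by (auto simp: mem_shift_down)
    obtain k where k: "a_num s x lam - x = s * k" using seg(1)[of x] by (auto elim: dvdE)
    have pos: "0 < s" using assms(1) by simp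
    \<comment> \<open>The number a - x is a multiple of s with 0 < a - x \<le> s, so it equals
      s.\<close>
    have "s * 0 < s * k" "s * k \<le> s * 1" using x k by linarith+
    then have "k = 1"
      unfolding mult_less_cancel_left_pos[OF pos] mult_le_cancel_left_pos[OF pos] by simp
    then have "x + s = a_num s x lam" using k by simp
    then show "x \<in> shift_down (s_set s lam) s" by (auto simp: mem_shift_down s_set_def)
  qed
qed

section \<open>The count in one residue class\<close>

theorem proposition3p4:
  fixes s t j :: int and lam :: "nat \<Rightarrow> nat"
  assumes "s \<ge> 1" and "t \<ge> 1" and "is_core s lam"
  shows "real (card (shift_down (s_set s lam) s \<inter> residue_class j t)) =
    1 / real_of_int t *
      real_of_int (a_num t j (core_of t lam) - (a_num t (j + s) (core_of t lam) - s))"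
proof -
  define mu where "mu = core_of t lam"
  have part: "is_partition lam" using assms(3) by (simp add: is_core_def)
  have mu: "(removes_hook t)\<^sup>*\<^sup>* lam mu" "is_core t mu"
    using core_of[OF assms(2) part] by (simp_all add: mu_def)
  define L where "L i = beta_set lam \<inter> residue_class i t" for i
  define M where "M i = beta_set mu \<inter> residue_class i t" for i
  let ?L' = "shift_down (L (j + s)) s" and ?M' = "shift_down (M (j + s)) s"
  have LM: "almost_eq (L i) (M i)" "rel_card (L i) (M i) = 0" for i
    using removes_hooks_rel_card[OF mu(1)] by (auto simp: L_def M_def)
  have M'L': "almost_eq ?M' ?L'" "rel_card ?M' ?L' = 0"
    using almost_eq_shift_down[OF almost_eq_sym[OF LM(1)]] LM(2)
      rel_card_swap[of "M (j + s)" "L (j + s)"] by (auto simp: rel_card_shift_down)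
  \<comment> \<open>p and q are the first elements of the class of j missing from the beta-set of
    the core and from its translate by -s.\<close>
  define p where "p = a_num t j mu"
  define q where "q = a_num t (j + s) mu - s"
  have pq: "t dvd (p - j)" "t dvd (q - j)"
    using core_beta_segment(1)[OF mu(2) assms(2)] by (auto simp: p_def q_def algebra_simps)
  have Mp: "M j = {x \<in> residue_class j t. x < p}"
    using core_beta_segment(2)[OF mu(2) assms(2)] by (simp add: M_def p_def)
  have Mq: "?M' = {x \<in> residue_class j t. x < q}"
    unfolding M_def core_beta_segment(2)[OF mu(2) assms(2), of "j + s"]
    by (auto simp: q_def mem_shift_down mem_residue_class)
  have MM': "almost_eq (M j) ?M'" "t * rel_card (M j) ?M' = p - q"
    unfolding Mp Mq using rel_card_residue_segments[OF assms(2) pq] by auto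
  \<comment> \<open>Passing from L to M, to the translate of M, and to the translate of L: the outer
    terms vanish because hook removal preserves relative size.\<close>
  have "rel_card (L j) ?L' = rel_card (L j) (M j) + (rel_card (M j) ?M' + rel_card ?M' ?L')"
    using rel_card_trans[OF LM(1)] rel_card_trans[OF MM'(1) M'L'(1)]
      almost_eq_trans[OF MM'(1) M'L'(1)] by metis
  then have *: "t * rel_card (L j) ?L' = p - q" using LM(2) M'L'(2) MM'(2) by simp
  have L': "?L' = shift_down (beta_set lam) s \<inter> residue_class j t"
    by (simp add: L_def shift_down_residue_class)
  \<comment> \<open>Since lam is an s-core, the translate is contained in the beta-set, so the
    relative size is an honest cardinality.\<close>
  have "shift_down (beta_set lam) s \<subseteq> beta_set lam"
    using core_beta_closed[OF assms(3,1)] by (force simp: shift_down_def)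
  then have "?L' - L j = {}" unfolding L' by (auto simp: L_def)
  moreover have "shift_down (s_set s lam) s \<inter> residue_class j t = L j - ?L'"
    unfolding L' shift_down_s_set[OF assms(1,3)] by (auto simp: L_def)
  ultimately have
    "rel_card (L j) ?L' = int (card (shift_down (s_set s lam) s \<inter> residue_class j t))"
    unfolding rel_card_def by (simp only: card.empty of_nat_0 diff_zero)
  then have "t * int (card (shift_down (s_set s lam) s \<inter> residue_class j t)) = p - q"
    using * by simp
  then have "real_of_int t * real (card (shift_down (s_set s lam) s \<inter> residue_class j t))
      = real_of_int (p - q)"
    by (metis of_int_mult of_int_of_nat_eq)
  then show ?thesis
    using assms(2) unfolding p_def q_def mu_def by (simp add: field_simps)
qed

end
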